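(* Let $T$ be an orientation of a caterpillar and let $P\subseteq T$ be its central path, with $m$ vertices. Then $\chi_{d}(T)\leq 2m-1$.
   Context: A caterpillar is a finite tree in which every vertex is at distance at most one from a central path; the central path $P$ is taken to be a longest path of the underlying undirected tree (it need not be a directed path). An orientation replaces each edge by exactly one of the two possible arcs. For a vertex $v$ of a digraph $D$, $N^{+}(v)$ denotes the open out-neighborhood, i.e. the set of vertices $w$ such that $(v,w)$ is an arc; $v$ dominates each vertex of $N^{+}(v)$. A dominator coloring of $D$ is a proper vertex coloring (adjacent vertices of the underlying graph receive different colors) such that every vertex $v$ with $N^{+}(v)\neq\emptyset$ dominates at least one color class, i.e. there is a nonempty color class contained in $N^{+}(v)$ (vertices of out-degree zero are exempt). The dominator chromatic number $\chi_{d}(D)$ is the minimum number of colors in a dominator coloring of $D$. *)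

theory Defs
  imports "Graph_Theory.Graph_Theory"
begin

text \<open>
  A finite simple undirected graph is a symmetric, loop-free, finite digraph whose arcs are pairs
  (locale \<^locale>\<open>pair_graph\<close>); an edge \<open>uv\<close> is the pair of arcs \<open>(u, v)\<close>, \<open>(v, u)\<close>.
\<close>

text \<open>
  The predicates \<open>tree\<close> and \<open>forest\<close> of the library forbid directed cycles, and for these \<open>u, v, u\<close>
  counts as a cycle in a symmetric digraph. Undirected cycles need at least three vertices.
\<close>

definition undirected_cycle :: "'a pair_pre_digraph \<Rightarrow> 'a list \<Rightarrow> bool" where
  "undirected_cycle G c \<longleftrightarrow>
     vpath c (with_proj G) \<and> 3 \<le> length c \<and> (last c, hd c) \<in> parcs G"

text \<open>The null graph is not connected in the sense of the library, hence not a tree.\<close>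

definition undirected_tree :: "'a pair_pre_digraph \<Rightarrow> bool" where
  "undirected_tree G \<longleftrightarrow>
     pair_graph G \<and> connected (with_proj G) \<and> (\<nexists>c. undirected_cycle G c)"

definition longest_path :: "'a pair_pre_digraph \<Rightarrow> 'a list \<Rightarrow> bool" where
  "longest_path G p \<longleftrightarrow>
     vpath p (with_proj G) \<and> (\<forall>q. vpath q (with_proj G) \<longrightarrow> length q \<le> length p)"

definition graph_dist :: "'a pair_pre_digraph \<Rightarrow> 'a \<Rightarrow> 'a \<Rightarrow> ereal" where
  "graph_dist G u v = wf_digraph.\<mu> (with_proj G) (\<lambda>_. 1) u v"

definition central_path :: "'a pair_pre_digraph \<Rightarrow> 'a list \<Rightarrow> bool" where
  "central_path G p \<longleftrightarrow>
     longest_path G p \<and> (\<forall>v \<in> pverts G. \<exists>u \<in> set p. graph_dist G v u \<le> 1)"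

definition caterpillar :: "'a pair_pre_digraph \<Rightarrow> bool" where
  "caterpillar G \<longleftrightarrow> undirected_tree G \<and> (\<exists>p. central_path G p)"

definition orientation :: "'a pair_pre_digraph \<Rightarrow> 'a pair_pre_digraph \<Rightarrow> bool" where
  "orientation D G \<longleftrightarrow>
     pverts D = pverts G \<and> parcs D \<subseteq> parcs G \<and>
     (\<forall>u v. (u, v) \<in> parcs G \<longrightarrow> ((u, v) \<in> parcs D) \<noteq> ((v, u) \<in> parcs D))"

definition out_nbhd :: "'a pair_pre_digraph \<Rightarrow> 'a \<Rightarrow> 'a set" where
  "out_nbhd D v = {w. (v, w) \<in> parcs D}"

definition color_class :: "'a pair_pre_digraph \<Rightarrow> ('a \<Rightarrow> nat) \<Rightarrow> nat \<Rightarrow> 'a set" where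
  "color_class D f c = {w \<in> pverts D. f w = c}"

definition proper_coloring :: "'a pair_pre_digraph \<Rightarrow> ('a \<Rightarrow> nat) \<Rightarrow> bool" where
  "proper_coloring D f \<longleftrightarrow> (\<forall>u v. (u, v) \<in> parcs D \<longrightarrow> f u \<noteq> f v)"

definition dominator_coloring :: "'a pair_pre_digraph \<Rightarrow> ('a \<Rightarrow> nat) \<Rightarrow> bool" where
  "dominator_coloring D f \<longleftrightarrow>
     proper_coloring D f \<and>
     (\<forall>v \<in> pverts D. out_nbhd D v \<noteq> {} \<longrightarrow>
        (\<exists>c. color_class D f c \<noteq> {} \<and> color_class D f c \<subseteq> out_nbhd D v))"

definition dominator_chromatic_number :: "'a pair_pre_digraph \<Rightarrow> nat" where
  "dominator_chromatic_number D =
     (LEAST k. \<exists>f. dominator_coloring D f \<and> card (f ` pverts D) = k)"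

text \<open>Every finite loop-free digraph has a dominator coloring, so the minimum is attained.\<close>

lemma dominator_coloring_exists:
  assumes "pair_digraph D"
  shows "\<exists>f. dominator_coloring D f"
proof -
  interpret pair_digraph D by fact
  obtain f :: "'a \<Rightarrow> nat" where f: "inj_on f (pverts D)"
    using finite_imp_inj_to_nat_seg[OF pair_finite_verts] by blast
  have "proper_coloring D f"
    unfolding proper_coloring_def
    by (metis f fst_conv in_arcsD1 in_arcsD2 inj_onD pair_no_loops snd_conv)
  moreover have "\<exists>c. color_class D f c \<noteq> {} \<and> color_class D f c \<subseteq> out_nbhd D v"
    if ne: "out_nbhd D v \<noteq> {}" for v
  proof -
    obtain w where w: "(v, w) \<in> parcs D" using ne by (auto simp: out_nbhd_def)
    then have "color_class D f (f w) = {w}"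
      using f in_arcsD2[OF w] by (auto simp: color_class_def dest: inj_onD)
    then show ?thesis using w by (intro exI[of _ "f w"]) (auto simp: out_nbhd_def)
  qed
  ultimately show ?thesis unfolding dominator_coloring_def by blast
qed

lemma graph_dist_le_1_iff:
  assumes "pair_graph G" "u \<in> pverts G"
  shows "graph_dist G u v \<le> 1 \<longleftrightarrow> u = v \<or> (u, v) \<in> parcs G"
proof -
  interpret pair_graph G by fact
  let ?c = "\<lambda>_::'a \<times> 'a. 1::real"
  have cost: "awalk_cost ?c p = length p" for p
    unfolding awalk_cost_def by (induct p) auto
  have mu: "graph_dist G u v = (INF p\<in>{p. awalk u p v}. ereal (length p))"
    unfolding graph_dist_def \<mu>_def cost ..
  show ?thesis
  proof
    assume "graph_dist G u v \<le> 1"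
    then have "(INF p\<in>{p. awalk u p v}. ereal (length p)) < ereal 2"
      unfolding mu by (rule le_less_trans) (simp add: one_ereal_def)
    then obtain p where p: "awalk u p v" "ereal (length p) < ereal 2"
      by (auto simp: INF_less_iff)
    then have "length p < 2" by simp
    then consider "p = []" | e where "p = [e]"
      by (cases p; cases "tl p") auto
    then show "u = v \<or> (u, v) \<in> parcs G"
      by cases (use p(1) in \<open>auto simp: awalk_def\<close>)
  next
    assume "u = v \<or> (u, v) \<in> parcs G"
    then have "\<exists>p. awalk u p v \<and> length p \<le> 1"
    proof
      assume "u = v"
      then show ?thesis using assms(2) by (intro exI[of _ "[]"]) (auto simp: awalk_def)
    next
      assume "(u, v) \<in> parcs G"
      then show ?thesis
        using assms(2) by (intro exI[of _ "[(u, v)]"]) (auto simp: awalk_def)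
    qed
    then obtain p where "awalk u p v" "length p \<le> 1" by blast
    then show "graph_dist G u v \<le> 1"
      unfolding mu by (intro INF_lower2[of p]) (auto simp: one_ereal_def)
  qed
qed

end

theory Submission
  imports Defs
begin

text \<open>
  Write the central path as \<open>p\<^sub>0, \<dots>, p\<^sub>m\<^sub>-\<^sub>1\<close>. Since the underlying graph is acyclic and the path is
  longest, the vertices off the path are leaves: no two of them are adjacent, each is adjacent to
  exactly one \<open>p\<^sub>i\<close>, and \<open>i\<close> is neither \<open>0\<close> nor \<open>m - 1\<close>.

  Give every path vertex a color of its own. For each inner \<open>p\<^sub>i\<close>, give all the leaves that \<open>p\<^sub>i\<close>
  dominates one common color that is used nowhere else, and give all remaining leaves (those that
  dominate their path neighbor) one last common color. This uses at most
  \<open>m + (m - 2) + 1 = 2 * m - 1\<close> colors (without inner vertices there are no leaves off the path, and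
  \<open>m\<close> colors suffice), and it is proper because two leaves are never adjacent and
  path vertices share their color with no other vertex.
  It is a dominator coloring: a vertex with an out-neighbor on the path dominates the singleton
  class of that out-neighbor; otherwise it is a path vertex \<open>p\<^sub>i\<close> whose out-neighbors are leaves, and
  it dominates the class of its leaves. Because a leaf has
  only one neighbor on the path, no leaf of \<open>p\<^sub>i\<close> is claimed by the class of another path vertex, so
  this class is there whenever it is needed.
\<close>

section \<open>Vertices off a longest path of a tree\<close>

lemma pair_graph_arc_sym:
  assumes "pair_graph G" "(u, v) \<in> parcs G"
  shows "(v, u) \<in> parcs G"
proof -
  interpret pair_graph G by fact
  show ?thesis
    using pair_sym_arcs assms(2) by (auto dest: arcs_ends_symmetric)
qed

lemma pair_graph_arcD:
  assumes "pair_graph G" "(u, v) \<in> parcs G"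
  shows "u \<in> pverts G" "v \<in> pverts G" "u \<noteq> v"
proof -
  interpret pair_graph G by fact
  show "u \<in> pverts G" "v \<in> pverts G" "u \<noteq> v"
    using assms(2) by (auto dest: in_arcsD1 in_arcsD2 pair_no_loops)
qed

lemma vpath_Cons:
  assumes "vpath p (with_proj G)" "v \<in> pverts G" "v \<notin> set p" "(v, hd p) \<in> parcs G"
  shows "vpath (v # p) (with_proj G)"
  using assms by (auto simp: vpath_def intro!: vwalk_consI)

lemma vpath_snoc:
  assumes "vpath p (with_proj G)" "v \<in> pverts G" "v \<notin> set p" "(last p, v) \<in> parcs G"
  shows "vpath (p @ [v]) (with_proj G)"
  using assms by (auto simp: vpath_def vwalk_def set_vwalk_arcs_snoc)

text \<open>Undirected cycles are built below by closing up such a segment outside the path.\<close>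

lemma vpath_segment:
  assumes "vpath p G" "i \<le> j" "j < length p"
  shows "vpath (drop i (take (Suc j) p)) G"
proof -
  have ne: "take (Suc j) p \<noteq> []" "drop i (take (Suc j) p) \<noteq> []" using assms(2,3) by auto
  have "vwalk (take (Suc j) p @ drop (Suc j) p) G"
    using assms(1) by (simp add: vpath_def)
  from vwalkI_append_l[OF ne(1) this] have "vwalk (take (Suc j) p) G" .
  then have "vwalk (take i (take (Suc j) p) @ drop i (take (Suc j) p)) G"
    by (simp only: append_take_drop_id)
  from vwalkI_append_r[OF ne(2) this] have "vwalk (drop i (take (Suc j) p)) G" .
  then show ?thesis using assms(1) by (simp add: vpath_def)
qed

text \<open>
  A way to leave a path and to come back to it outside the path closes an undirected cycle
  with the segment in between. The disjunction covers the two detours that matter: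
  through one vertex and through one edge.
\<close>

lemma undirected_tree_detour:
  assumes tree: "undirected_tree G" and p: "vpath p (with_proj G)"
    and ij: "i \<le> j" "j < length p"
    and off: "x \<notin> set p" "y \<notin> set p"
    and arcs: "(x, p ! i) \<in> parcs G" "(p ! j, y) \<in> parcs G"
    and xy: "x = y \<or> (y, x) \<in> parcs G"
  shows "x = y \<and> i = j"
proof -
  have G: "pair_graph G" and acyclic: "\<And>c. \<not> undirected_cycle G c"
    using tree by (auto simp: undirected_tree_def)
  let ?s = "drop i (take (Suc j) p)"
  have s: "vpath ?s (with_proj G)" using p ij by (rule vpath_segment)
  have len: "length ?s = Suc j - i" using ij by simp
  have hd: "hd ?s = p ! i" using ij by (simp add: hd_drop_conv_nth)
  have last: "last ?s = p ! j"
    using ij by (simp add: take_Suc_conv_app_nth)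
  have set: "set ?s \<subseteq> set p" by (meson set_drop_subset set_take_subset subset_trans)
  have ne: "?s \<noteq> []" using len ij by auto
  have xs: "vpath (x # ?s) (with_proj G)"
    using s off(1) set arcs(1) hd pair_graph_arcD(1)[OF G arcs(1)] by (intro vpath_Cons) auto
  show ?thesis
  proof (cases "x = y")
    case True
    have "i = j"
    proof (rule ccontr)
      assume "i \<noteq> j"
      then have "3 \<le> length (x # ?s)" using len ij by simp
      moreover have "(last (x # ?s), hd (x # ?s)) \<in> parcs G"
        using arcs(2) last ne True by simp
      ultimately show False using xs acyclic[of "x # ?s"] unfolding undirected_cycle_def by blast
    qed
    then show ?thesis using True by simp
  next
    case False
    let ?c = "(x # ?s) @ [y]"
    have "vpath ?c (with_proj G)"
      using xs False off(2) set arcs(2) last ne pair_graph_arcD(2)[OF G arcs(2)]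
      by (intro vpath_snoc) auto
    moreover have "3 \<le> length ?c" using len ij by simp
    moreover have "(last ?c, hd ?c) \<in> parcs G" using xy False by simp
    ultimately show ?thesis using acyclic[of ?c] unfolding undirected_cycle_def by blast
  qed
qed

lemma path_neighbor_unique:
  assumes "undirected_tree G" "vpath p (with_proj G)" "v \<notin> set p"
    and "i < length p" "j < length p" "(v, p ! i) \<in> parcs G" "(v, p ! j) \<in> parcs G"
  shows "i = j"
proof -
  have G: "pair_graph G" using assms(1) by (simp add: undirected_tree_def)
  show ?thesis
  proof (cases "i \<le> j")
    case True
    then show ?thesis
      using undirected_tree_detour[OF assms(1,2) True assms(5,3,3,6)]
        pair_graph_arc_sym[OF G assms(7)] by simp
  next
    case False
    then have "j \<le> i" by simp
    then show ?thesis
      using undirected_tree_detour[OF assms(1,2) _ assms(4,3,3,7)]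
        pair_graph_arc_sym[OF G assms(6)] by simp
  qed
qed

text \<open>
  An edge between two vertices outside the path is a detour from one path neighbor to the other.
  Both path neighbors may coincide, and then the cycle is a triangle.
\<close>

lemma path_neighbors_independent:
  assumes tree: "undirected_tree G" and "vpath p (with_proj G)" "x \<notin> set p" "y \<notin> set p"
    and "i < length p" "j < length p" "(x, p ! i) \<in> parcs G" "(y, p ! j) \<in> parcs G"
  shows "(x, y) \<notin> parcs G"
proof
  assume xy: "(x, y) \<in> parcs G"
  have G: "pair_graph G" using tree by (simp add: undirected_tree_def)
  note sym = pair_graph_arc_sym[OF G]
  have "x = y"
  proof (cases "i \<le> j")
    case True
    then show ?thesis
      using undirected_tree_detour[OF tree assms(2) True assms(6,3,4,7)] sym[OF assms(8)] sym[OF xy]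
      by simp
  next
    case False
    then have "j \<le> i" by simp
    then show ?thesis
      using undirected_tree_detour[OF tree assms(2) _ assms(5,4,3,8)] sym[OF assms(7)] xy by simp
  qed
  then show False using pair_graph_arcD(3)[OF G xy] by simp
qed

text \<open>A neighbor of an end outside the path could be attached there to give a longer path.\<close>

lemma longest_path_end_neighbor:
  assumes "pair_graph G" "longest_path G p" "v \<notin> set p" "i < length p" "(v, p ! i) \<in> parcs G"
  shows "0 < i" "i < length p - 1"
proof -
  have p: "vpath p (with_proj G)" and max: "\<And>q. vpath q (with_proj G) \<Longrightarrow> length q \<le> length p"
    using assms(2) by (auto simp: longest_path_def)
  have ne: "p \<noteq> []" using assms(4) by auto
  have v: "v \<in> pverts G" using pair_graph_arcD(1)[OF assms(1,5)] .
  have "(v, hd p) \<notin> parcs G"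
    using max[OF vpath_Cons[OF p v assms(3)]] by auto
  then show "0 < i" using assms(5) ne by (cases i) (auto simp: hd_conv_nth)
  have "(last p, v) \<notin> parcs G"
    using max[OF vpath_snoc[OF p v assms(3)]] by auto
  moreover have "(p ! i, v) \<in> parcs G" using pair_graph_arc_sym[OF assms(1,5)] .
  ultimately have "i \<noteq> length p - 1" using ne by (auto simp: last_conv_nth)
  then show "i < length p - 1" using assms(4) by simp
qed

section \<open>The coloring\<close>

lemma dominator_chromatic_number_le:
  assumes "dominator_coloring D f" "f ` pverts D \<subseteq> {..<k}"
  shows "dominator_chromatic_number D \<le> k"
proof -
  have "dominator_chromatic_number D \<le> card (f ` pverts D)"
    unfolding dominator_chromatic_number_def using assms(1) by (intro Least_le) blast
  also have "\<dots> \<le> card {..<k}" using assms(2) by (intro card_mono) auto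
  finally show ?thesis by simp
qed

text \<open>
  A leaf dominated by \<open>p ! i\<close> gets the color \<open>length p + i\<close>. As the ends of a central path
  have no leaves, \<open>length p + 0\<close> is free for the leaves without in-neighbor on the path, and this
  keeps the colors below \<open>2 * length p - 1\<close>. The descriptions pick unique indices when \<open>p\<close> is a
  path and every vertex outside it has only one neighbor on it.
\<close>

definition caterpillar_coloring :: "'a pair_pre_digraph \<Rightarrow> 'a list \<Rightarrow> 'a \<Rightarrow> nat" where
  "caterpillar_coloring D p v =
     (if v \<in> set p then (THE i. i < length p \<and> p ! i = v)
      else if \<exists>i<length p. (p ! i, v) \<in> parcs D
      then length p + (THE i. i < length p \<and> (p ! i, v) \<in> parcs D)
      else length p)"

theorem lemma8:
  fixes C T :: "'a pair_pre_digraph" and P :: "'a list" and m :: nat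
  assumes "caterpillar C"
    and "orientation T C"
    and "central_path C P"
    and "m = length P"
  shows "dominator_chromatic_number T \<le> 2 * m - 1"
proof -
  have tree: "undirected_tree C" using assms(1) by (simp add: caterpillar_def)
  then have C: "pair_graph C" by (simp add: undirected_tree_def)
  have longest: "longest_path C P"
    and near: "\<And>v. v \<in> pverts C \<Longrightarrow> \<exists>u\<in>set P. graph_dist C v u \<le> 1"
    using assms(3) by (auto simp: central_path_def)
  then have path: "vpath P (with_proj C)" by (simp add: longest_path_def)
  then have dist: "distinct P" and P_ne: "P \<noteq> []" by (auto simp: vpath_def vwalk_def)
  have verts: "pverts T = pverts C" and sub: "\<And>u v. (u, v) \<in> parcs T \<Longrightarrow> (u, v) \<in> parcs C"
    and some_arc: "\<And>u v. (u, v) \<in> parcs C \<Longrightarrow> (u, v) \<in> parcs T \<or> (v, u) \<in> parcs T"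
    using assms(2) unfolding orientation_def by blast+
  have rev: "(v, u) \<in> parcs C" if "(u, v) \<in> parcs T" for u v
    using pair_graph_arc_sym[OF C sub[OF that]] .
  note inv = pair_graph_arcD[OF C]
  note unique = path_neighbor_unique[OF tree path]

  have leaf: "\<exists>i<m. (v, P ! i) \<in> parcs C" if v: "v \<in> pverts C" "v \<notin> set P" for v
  proof -
    obtain u where "u \<in> set P" "graph_dist C v u \<le> 1" using near v(1) by blast
    then have "u \<in> set P" "(v, u) \<in> parcs C"
      using graph_dist_le_1_iff[OF C v(1)] v(2) by auto
    then show ?thesis using assms(4) by (auto simp: in_set_conv_nth)
  qed
  have off_indep: "x \<in> set P \<or> y \<in> set P" if xy: "(x, y) \<in> parcs T" for x y
  proof (rule ccontr)
    assume "\<not> (x \<in> set P \<or> y \<in> set P)"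
    then have off: "x \<notin> set P" "y \<notin> set P" by auto
    obtain i where "i < m" "(x, P ! i) \<in> parcs C"
      using leaf[OF inv(1)[OF sub[OF xy]] off(1)] by blast
    moreover obtain j where "j < m" "(y, P ! j) \<in> parcs C"
      using leaf[OF inv(2)[OF sub[OF xy]] off(2)] by blast
    ultimately show False
      using path_neighbors_independent[OF tree path off] sub[OF xy] assms(4) by blast
  qed

  define f where "f = caterpillar_coloring T P"
  have f_path: "f (P ! i) = i" if "i < m" for i
  proof -
    have "(THE j. j < length P \<and> P ! j = P ! i) = i"
      using that assms(4) dist by (intro the_equality) (auto simp: nth_eq_iff_index_eq)
    then show ?thesis using that assms(4) by (simp add: f_def caterpillar_coloring_def)
  qed
  have f_out: "f v = m + i" if "v \<notin> set P" "i < m" "(P ! i, v) \<in> parcs T" for v i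
  proof -
    have only: "j = i" if "j < length P" "(P ! j, v) \<in> parcs T" for j
      using unique[of v j i] that \<open>v \<notin> set P\<close> \<open>i < m\<close> rev[OF \<open>(P ! i, v) \<in> parcs T\<close>]
        rev[OF that(2)] assms(4) by simp
    have "(THE j. j < length P \<and> (P ! j, v) \<in> parcs T) = i"
      by (rule the_equality) (use that assms(4) only in blast)+
    then show ?thesis using that assms(4) by (auto simp: f_def caterpillar_coloring_def)
  qed
  have f_in: "f v = m" if "v \<notin> set P" "\<not> (\<exists>i<m. (P ! i, v) \<in> parcs T)" for v
    using that assms(4) by (auto simp: f_def caterpillar_coloring_def)

  have f_off: "m \<le> f v \<and> f v < 2 * m - 1" if v: "v \<in> pverts C" "v \<notin> set P" for v
  proof -
    obtain i where i: "i < m" "(v, P ! i) \<in> parcs C" using leaf[OF v] by blast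
    \<comment> \<open>The two ends have no leaves: this is what saves two of the \<open>2 * m + 1\<close> obvious colors.\<close>
    then have pos: "0 < i" "i < m - 1"
      using longest_path_end_neighbor[OF C longest v(2)] assms(4) by auto
    show ?thesis
    proof (cases "\<exists>j<m. (P ! j, v) \<in> parcs T")
      case True
      then obtain j where j: "j < m" "(P ! j, v) \<in> parcs T" by blast
      then have "j = i" using unique[OF v(2)] i assms(4) rev[OF j(2)] by simp
      then show ?thesis using f_out[OF v(2) j] pos by simp
    next
      case False
      then show ?thesis using f_in[OF v(2)] pos by simp
    qed
  qed
  have f_path_iff: "f v < m \<longleftrightarrow> v \<in> set P" if "v \<in> pverts C" for v
    using f_off[OF that] f_path assms(4) by (fastforce simp: in_set_conv_nth)
  have singleton: "color_class T f i = {P ! i}" if "i < m" for i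
  proof -
    have "P ! i \<in> pverts C"
      using path that assms(4) by (auto simp: vpath_def vwalk_def)
    moreover have "v = P ! i" if v: "v \<in> pverts C" "f v = i" for v
    proof -
      have "v \<in> set P" using f_path_iff[OF v(1)] v(2) \<open>i < m\<close> by simp
      then obtain j where "j < m" "v = P ! j" using assms(4) by (auto simp: in_set_conv_nth)
      then show ?thesis using f_path v(2) by simp
    qed
    ultimately show ?thesis
      using f_path[OF that] verts unfolding color_class_def by blast
  qed

  have "proper_coloring T f"
    unfolding proper_coloring_def
  proof (intro allI impI)
    fix u v assume uv: "(u, v) \<in> parcs T"
    note C_uv = inv[OF sub[OF uv]]
    show "f u \<noteq> f v"
    proof
      assume eq: "f u = f v"
      \<comment> \<open>One end of the arc lies on the path, and its color class is a singleton.\<close>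
      then have "f u < m" using off_indep[OF uv] f_path_iff[OF C_uv(1)] f_path_iff[OF C_uv(2)] by auto
      then have "u \<in> color_class T f (f u)" "v \<in> color_class T f (f u)"
        using C_uv eq verts by (auto simp: color_class_def)
      then show False using singleton[OF \<open>f u < m\<close>] C_uv(3) by simp
    qed
  qed
  moreover have "\<exists>c. color_class T f c \<noteq> {} \<and> color_class T f c \<subseteq> out_nbhd T v"
    if ne: "out_nbhd T v \<noteq> {}" for v
  proof (cases "\<exists>i<m. (v, P ! i) \<in> parcs T")
    case True
    then obtain i where "i < m" "(v, P ! i) \<in> parcs T" by blast
    then show ?thesis using singleton by (intro exI[of _ i]) (auto simp: out_nbhd_def)
  next
    case False
    obtain w where w: "(v, w) \<in> parcs T" using ne by (auto simp: out_nbhd_def)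
    then have "w \<notin> set P" using False assms(4) by (auto simp: in_set_conv_nth)
    then obtain i where i: "i < m" "v = P ! i"
      using off_indep[OF w] assms(4) by (auto simp: in_set_conv_nth)
    \<comment> \<open>All out-neighbors of \<open>v\<close> are leaves, so \<open>v\<close> dominates the class of its leaves.\<close>
    have "0 < i"
      using longest_path_end_neighbor(1)[OF C longest \<open>w \<notin> set P\<close>] i assms(4) rev[OF w] by simp
    have "w \<in> color_class T f (m + i)"
      using f_out[OF \<open>w \<notin> set P\<close> i(1)] w i verts inv(2)[OF sub[OF w]]
      by (simp add: color_class_def)
    moreover have "(v, x) \<in> parcs T" if "x \<in> color_class T f (m + i)" for x
    proof -
      have x: "x \<in> pverts C" "f x = m + i" using that verts by (auto simp: color_class_def)
      then have "x \<notin> set P" using f_path_iff[OF x(1)] by simp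
      \<comment> \<open>Since \<open>i\<close> is positive, this is not the color of the leaves that dominate their neighbor.\<close>
      then obtain j where j: "j < m" "(P ! j, x) \<in> parcs T"
        using f_in[OF \<open>x \<notin> set P\<close>] x(2) \<open>0 < i\<close> by auto
      then have "j = i" using f_out[OF \<open>x \<notin> set P\<close> j] x(2) by simp
      then show ?thesis using j i by simp
    qed
    ultimately show ?thesis by (auto simp: out_nbhd_def)
  qed
  ultimately have "dominator_coloring T f" by (simp add: dominator_coloring_def)
  moreover have "f ` pverts T \<subseteq> {..<2 * m - 1}"
  proof
    fix c assume "c \<in> f ` pverts T"
    then obtain v where v: "v \<in> pverts C" "c = f v" using verts by auto
    show "c \<in> {..<2 * m - 1}"
      using f_off[OF v(1)] f_path_iff[OF v(1)] v(2) by (cases "v \<in> set P") auto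
  qed
  ultimately show ?thesis by (rule dominator_chromatic_number_le)
qed

end
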